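(* Let a rotor sequence be fixed. For any initial rotor directions $\mathrm{ARR}(\cdot,0):V\to\mathrm{DIR}$ and any $\pi:V\times\mathbb{N}_0\to\{0,1,2,3\}$ with $\pi(\mathbf{x},t)=0$ for all $\mathbf{x}\not\sim t$, there is an even initial configuration, with these initial rotor directions and with chip numbers $f(\mathbf{x},0)\in\mathbb{N}_0$, $\mathbf{x}\in V$, such that the resulting run of the Propp machine satisfies $f(\mathbf{x},t)\equiv\pi(\mathbf{x},t)\pmod 4$ for all $\mathbf{x}\in V$ and all $t\in\mathbb{N}_0$.
   Context: Let $V=\{(x_1,x_2)\in\mathbb{Z}^2: x_1\equiv x_2 \pmod 2\}$ and $\mathrm{DIR}=\{(1,1),(1,-1),(-1,-1),(-1,1)\}$; the neighbors of $\mathbf{x}\in V$ are $\mathbf{x}+\mathbf{A}$, $\mathbf{A}\in\mathrm{DIR}$. Write $\mathbf{x}\sim t$ if $x_1\equiv x_2\equiv t \pmod 2$, and $\mathbf{x}\not\sim t$ otherwise. A rotor sequence is a cyclic permutation (a single 4-cycle) $\mathrm{NEXT}:\mathrm{DIR}\to\mathrm{DIR}$, used at all vertices. Propp machine: an initial configuration assigns to each $\mathbf{x}\in V$ a number $f(\mathbf{x},0)\in\mathbb{N}_0$ of chips and a rotor direction $\mathrm{ARR}(\mathbf{x},0)\in\mathrm{DIR}$ (infinitely many vertices may hold chips). In one step each chip present makes exactly one move: the chips on a vertex leave one after another, each moving one step in the direction the rotor of that vertex currently points, after which this rotor is updated from $\mathbf{A}$ to $\mathrm{NEXT}(\mathbf{A})$.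 $f(\mathbf{x},t)$ is the number of chips on $\mathbf{x}$ after $t$ steps. A configuration is even if all chips lie on vertices $\mathbf{x}\sim 0$. *)

theory Defs
  imports
    "HOL-Number_Theory.Cong"
    "HOL-Combinatorics.Orbits"
    "HOL-Library.Product_Plus"
    "HOL-Library.FuncSet"
begin

type_synonym point = "int \<times> int"

definition V :: "point set" where
  "V = {(x1, x2). [x1 = x2] (mod 2)}"

definition DIR :: "point set" where
  "DIR = {(1, 1), (1, -1), (-1, -1), (-1, 1)}"

definition parity_match :: "point \<Rightarrow> nat \<Rightarrow> bool" (infix "\<sim>" 50) where
  "x \<sim> t \<longleftrightarrow> [fst x = snd x] (mod 2) \<and> [snd x = int t] (mod 2)"

definition rotor_sequence :: "(point \<Rightarrow> point) \<Rightarrow> bool" where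
  "rotor_sequence NEXT \<longleftrightarrow> bij_betw NEXT DIR DIR \<and> cyclic_on NEXT DIR"

record config =
  chips :: "point \<Rightarrow> nat"
  rotor :: "point \<Rightarrow> point"

text \<open>
  If a vertex holds n chips and its rotor points to A, the chips leave one after another, the
  k-th of them (counted from 0) in direction \<open>(NEXT ^^ k) A\<close>, and the rotor ends up at
  \<open>(NEXT ^^ n) A\<close>. So \<open>sent NEXT n A B\<close> is the number of chips that leave in direction B.
\<close>

definition sent :: "(point \<Rightarrow> point) \<Rightarrow> nat \<Rightarrow> point \<Rightarrow> point \<Rightarrow> nat" where
  "sent NEXT n A B = card {k \<in> {..<n}. (NEXT ^^ k) A = B}"

text \<open>
  All chips move in each step, so afterwards a vertex holds exactly the chips that arrived from
  its neighbours. Configurations are total functions on the integer plane; neighbours of points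
  of V lie in V, so the values outside V have no influence on V.
\<close>

definition propp_step :: "(point \<Rightarrow> point) \<Rightarrow> config \<Rightarrow> config" where
  "propp_step NEXT c =
    \<lparr> chips = (\<lambda>x. \<Sum>A\<in>DIR. sent NEXT (chips c (x - A)) (rotor c (x - A)) A),
      rotor = (\<lambda>x. (NEXT ^^ chips c x) (rotor c x)) \<rparr>"

definition propp_run :: "(point \<Rightarrow> point) \<Rightarrow> config \<Rightarrow> nat \<Rightarrow> config" where
  "propp_run NEXT c t = (propp_step NEXT ^^ t) c"

text \<open>Since \<open>x \<sim> 0\<close> implies membership in V, this also excludes chips outside V.\<close>

definition even_config :: "config \<Rightarrow> bool" where
  "even_config c \<longleftrightarrow> (\<forall>x. chips c x > 0 \<longrightarrow> x \<sim> 0)"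

end

theory Submission
  imports Defs
begin

text \<open>
  Four chips leaving a vertex go once in each direction and turn the rotor back to where it was.
  Hence adding \<open>4 * m\<close> chips to a vertex sends \<open>m\<close> additional chips to each neighbour and changes
  nothing else. So if \<open>4 ^ T * e x\<close> chips are added on every vertex \<open>x\<close> of the initial
  configuration, then up to time \<open>T\<close> the rotors are unchanged, and at a time \<open>s \<le> T\<close> the
  additional chips are \<open>4 ^ (T - s) * (spread ^^ s) e\<close>, where \<open>spread\<close> sums a function over the
  neighbours of a point (\<open>propp_run_add_piles\<close>). The residues modulo 4 before time \<open>T\<close> are
  therefore unchanged, and those at time \<open>T\<close> change by \<open>(spread ^^ T) e\<close>.

  The residues can thus be prescribed one time step after the other, provided that
  \<open>(spread ^^ T) e\<close> can be any function modulo 4. In fact \<open>spread\<close> is onto already over the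
  integers: it is the composition of the operators \<open>h \<mapsto> h (x - 1) + h (x + 1)\<close> in the two
  coordinates, and such an equation is solved by a two-term recurrence starting from 0 in both
  directions.

  Infinitely many corrections are made, and their sum must be finite on each vertex. Solving the
  recurrence from zero initial values widens a strip \<open>\<bar>x\<^sub>1\<bar> < n\<close> of zeros of the right-hand side to
  \<open>\<bar>x\<^sub>1\<bar> \<le> n\<close>, so the correction for time \<open>T\<close> can be chosen to vanish for \<open>\<bar>x\<^sub>1\<bar> < T\<close>
  (\<open>exists_piles\<close>). Each vertex is then corrected only finitely often. The total of the corrections
  from time \<open>T\<close> on is \<open>4 ^ T\<close> times a function, so the limit configuration agrees modulo 4 with the
  \<open>T\<close>-th approximation at all times before \<open>T\<close>.
\<close>

section \<open>Blocks of four chips\<close>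

lemma card_DIR: "card DIR = 4"
  by (simp add: DIR_def)

lemma NEXT_in_DIR:
  assumes "rotor_sequence NEXT" "A \<in> DIR"
  shows "NEXT A \<in> DIR"
  using assms by (auto simp: rotor_sequence_def bij_betw_def)

lemma funpow_NEXT_in_DIR:
  assumes "rotor_sequence NEXT" "A \<in> DIR"
  shows "(NEXT ^^ n) A \<in> DIR"
  using assms by (induction n) (auto intro: NEXT_in_DIR)

lemma rotor_period:
  assumes "rotor_sequence NEXT" "A \<in> DIR"
  shows bij_betw_four_moves: "bij_betw (\<lambda>k. (NEXT ^^ k) A) {0..<4} DIR"
    and funpow_four: "(NEXT ^^ 4) A = A"
proof -
  have orb: "orbit NEXT A = DIR" "A \<in> orbit NEXT A"
    using assms unfolding rotor_sequence_def cyclic_on_alldef by auto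
  have inj: "inj_on (\<lambda>n. (NEXT ^^ n) A) {0..<funpow_dist1 NEXT A A}"
    using orb(2) by (rule inj_on_funpow_dist1)
  have img: "DIR = (\<lambda>n. (NEXT ^^ n) A) ` {0..<funpow_dist1 NEXT A A}"
    using orbit_conv_funpow_dist1[OF orb(2)] orb(1) by simp
  have "funpow_dist1 NEXT A A = card DIR"
    by (subst img, subst card_image[OF inj]) simp
  then have d: "funpow_dist1 NEXT A A = 4" by (simp add: card_DIR)
  show "bij_betw (\<lambda>k. (NEXT ^^ k) A) {0..<4} DIR"
    using inj img d by (simp add: bij_betw_def)
  show "(NEXT ^^ 4) A = A"
    using funpow_dist1_prop[OF orb(2)] d by simp
qed

lemma funpow_add_four_times:
  assumes "rotor_sequence NEXT" "A \<in> DIR"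
  shows "(NEXT ^^ (n + 4 * m)) A = (NEXT ^^ n) A"
proof (induction m)
  case (Suc m)
  have "(NEXT ^^ (n + 4 * Suc m)) A = (NEXT ^^ (n + 4 * m)) ((NEXT ^^ 4) A)"
    using funpow_add[of "n + 4 * m" 4 NEXT] by (simp only: mult_Suc_right add.commute add.left_commute comp_apply)
  with Suc show ?case by (simp only: funpow_four[OF assms])
qed simp

lemma sent_0 [simp]: "sent NEXT 0 A B = 0"
  by (simp add: sent_def)

lemma sent_add_four:
  assumes "rotor_sequence NEXT" "A \<in> DIR" "B \<in> DIR"
  shows "sent NEXT (n + 4) A B = sent NEXT n A B + 1"
proof -
  let ?C = "(NEXT ^^ n) A"
  have C: "?C \<in> DIR" using assms by (simp add: funpow_NEXT_in_DIR)
  obtain j where j: "j < 4" "(NEXT ^^ j) ?C = B"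
    using bij_betw_four_moves[OF assms(1) C] assms(3) unfolding bij_betw_def by force
  have uniq: "i = j" if "i < 4" "(NEXT ^^ i) ?C = B" for i
    using bij_betw_imp_inj_on[OF bij_betw_four_moves[OF assms(1) C]] j that
    by (auto simp: inj_on_def)
  have pow: "(NEXT ^^ (n + i)) A = (NEXT ^^ i) ?C" for i
    by (subst add.commute) (simp add: funpow_add)
  have "{k \<in> {..<n + 4}. (NEXT ^^ k) A = B} = insert (n + j) {k \<in> {..<n}. (NEXT ^^ k) A = B}"
    (is "?L = ?R")
  proof
    show "?R \<subseteq> ?L" using j pow[of j] by auto
    show "?L \<subseteq> ?R"
    proof
      fix k assume k: "k \<in> ?L"
      show "k \<in> ?R"
      proof (cases "k < n")
        case False
        then have "k - n = j" using k pow[of "k - n"] by (intro uniq) auto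
        then show ?thesis using False by auto
      qed (use k in auto)
    qed
  qed
  then show ?thesis by (simp add: sent_def)
qed

lemma sent_add_four_times:
  assumes "rotor_sequence NEXT" "A \<in> DIR" "B \<in> DIR"
  shows "sent NEXT (n + 4 * m) A B = sent NEXT n A B + m"
proof (induction m)
  case (Suc m)
  then show ?case using sent_add_four[OF assms, of "n + 4 * m"] by (simp add: algebra_simps)
qed simp

section \<open>Piles of \<open>4 ^ T\<close> chips move linearly for \<open>T\<close> steps\<close>

text \<open>
  The sum over the four neighbours. The value type is arbitrary because numbers of chips are natural
  numbers, while the linear system is solved over the integers.
\<close>

definition spread :: "(point \<Rightarrow> 'a::comm_monoid_add) \<Rightarrow> point \<Rightarrow> 'a" where
  "spread e x = (\<Sum>A\<in>DIR. e (x - A))"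

lemma spread_scale:
  "spread (\<lambda>x. c * e x) = (\<lambda>x. c * spread e x)" for c :: "'a::semiring_0"
  by (simp add: spread_def sum_distrib_left fun_eq_iff)

lemma V_diff_DIR: "x \<in> V \<Longrightarrow> A \<in> DIR \<Longrightarrow> x - A \<in> V"
  by (auto simp: V_def DIR_def cong_iff_dvd_diff)

lemma parity_match_diff_DIR: "A \<in> DIR \<Longrightarrow> x - A \<sim> t \<longleftrightarrow> x \<sim> Suc t"
  by (cases x) (auto simp: parity_match_def DIR_def cong_iff_dvd_diff)

lemma propp_run_0 [simp]: "propp_run NEXT c 0 = c"
  and propp_run_Suc: "propp_run NEXT c (Suc t) = propp_step NEXT (propp_run NEXT c t)"
  by (simp_all add: propp_run_def)

lemma rotor_propp_run_in_DIR:
  assumes "rotor_sequence NEXT" "rotor c \<in> V \<rightarrow> DIR"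
  shows "rotor (propp_run NEXT c t) \<in> V \<rightarrow> DIR"
  using assms by (induction t) (auto simp: propp_run_Suc propp_step_def funpow_NEXT_in_DIR Pi_iff)

lemma chips_propp_run_parity:
  assumes "even_config c" "\<not> x \<sim> t"
  shows "chips (propp_run NEXT c t) x = 0"
  using assms(2)
proof (induction t arbitrary: x)
  case 0
  then show ?case using assms(1) by (metis even_config_def gr0I propp_run_0)
next
  case (Suc t)
  then show ?case
    by (simp add: propp_run_Suc propp_step_def parity_match_diff_DIR)
qed

lemma propp_step_add_four_times:
  assumes "rotor_sequence NEXT" "rotor c \<in> V \<rightarrow> DIR"
    and "\<And>x. x \<in> V \<Longrightarrow> chips c' x = chips c x + 4 * m x"
    and "\<And>x. x \<in> V \<Longrightarrow> rotor c' x = rotor c x"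
    and "x \<in> V"
  shows "chips (propp_step NEXT c') x = chips (propp_step NEXT c) x + spread m x"
    and "rotor (propp_step NEXT c') x = rotor (propp_step NEXT c) x"
proof -
  have "sent NEXT (chips c' (x - A)) (rotor c' (x - A)) A
      = sent NEXT (chips c (x - A)) (rotor c (x - A)) A + m (x - A)" if "A \<in> DIR" for A
    using assms(2) V_diff_DIR[OF assms(5) that] sent_add_four_times[OF assms(1) _ that]
    by (simp add: assms(3,4) Pi_iff)
  then show "chips (propp_step NEXT c') x = chips (propp_step NEXT c) x + spread m x"
    by (simp add: propp_step_def spread_def sum.distrib)
  show "rotor (propp_step NEXT c') x = rotor (propp_step NEXT c) x"
    using assms(2,5) by (simp add: propp_step_def assms(3,4) Pi_iff funpow_add_four_times[OF assms(1)])
qed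

text \<open>
  Only vertices of V are compared: nothing is known about rotors outside V, and they do not
  influence V.
\<close>

lemma propp_run_add_piles:
  assumes "rotor_sequence NEXT" "rotor c \<in> V \<rightarrow> DIR"
    and "\<And>x. x \<in> V \<Longrightarrow> chips c' x = chips c x + 4 ^ T * e x"
    and "\<And>x. x \<in> V \<Longrightarrow> rotor c' x = rotor c x"
    and "s \<le> T" "x \<in> V"
  shows "chips (propp_run NEXT c' s) x = chips (propp_run NEXT c s) x
          + 4 ^ (T - s) * (spread ^^ s) e x \<and>
         rotor (propp_run NEXT c' s) x = rotor (propp_run NEXT c s) x"
  using assms(5,6)
proof (induction s arbitrary: x)
  case 0
  then show ?case using assms(3,4) by simp
next
  case (Suc s)
  let ?m = "\<lambda>x. 4 ^ (T - Suc s) * (spread ^^ s) e x"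
  have pow: "(4::nat) ^ (T - s) = 4 * 4 ^ (T - Suc s)"
    using Suc.prems(1) by (simp flip: power_Suc add: Suc_diff_Suc)
  have IH: "chips (propp_run NEXT c' s) y = chips (propp_run NEXT c s) y + 4 * ?m y"
    "rotor (propp_run NEXT c' s) y = rotor (propp_run NEXT c s) y" if "y \<in> V" for y
    using Suc.IH[OF _ that] Suc.prems(1) by (simp_all add: pow mult.assoc)
  show ?case
    using propp_step_add_four_times[OF assms(1) rotor_propp_run_in_DIR[OF assms(1,2)] IH Suc.prems(2)]
    by (simp add: propp_run_Suc spread_scale)
qed

section \<open>Solving the linear system for the piles\<close>

text \<open>
  The solution \<open>h 0, h 1, h 2, \<dots>\<close> of \<open>h (x - 1) + h (x + 1) = g x\<close> for \<open>x \<ge> 1\<close> with \<open>h 0 = 0\<close> and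
  \<open>h 1 = a\<close>.
\<close>

fun recurrence :: "(int \<Rightarrow> int) \<Rightarrow> int \<Rightarrow> nat \<Rightarrow> int" where
  "recurrence g a 0 = 0"
| "recurrence g a (Suc 0) = a"
| "recurrence g a (Suc (Suc k)) = g (int k + 1) - recurrence g a k"

lemma recurrence_eq_0:
  assumes "\<And>j. \<bar>j\<bar> < int n \<Longrightarrow> g j = 0" "0 < n \<Longrightarrow> a = 0" "k \<le> n"
  shows "recurrence g a k = 0"
  using assms(3) by (induction k rule: induct_nat_012) (use assms(1,2) in auto)

text \<open>
  The second conjunct says that zeros of the right-hand side on \<open>\<bar>y\<bar> < n\<close> give zeros of this solution
  on \<open>\<bar>x\<bar> \<le> n\<close>. It holds for all \<open>n\<close> simultaneously, so the solution for \<open>g = 0\<close> is \<open>h = 0\<close>.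
\<close>

lemma neighbour_sum_surj:
  fixes g :: "int \<Rightarrow> int"
  shows "\<exists>h. (\<forall>x. h (x - 1) + h (x + 1) = g x) \<and>
    (\<forall>n. (\<forall>y. \<bar>y\<bar> < int n \<longrightarrow> g y = 0) \<longrightarrow> (\<forall>x. \<bar>x\<bar> \<le> int n \<longrightarrow> h x = 0))"
proof -
  define h where "h x = (if x \<ge> 0 then recurrence g 0 (nat x)
    else recurrence (\<lambda>y. g (- y)) (g 0) (nat (- x)))" for x
  \<comment> \<open>\<open>h 0 = h 1 = 0\<close>, so the equation at \<open>x = 0\<close> forces \<open>h (- 1) = g 0\<close>.\<close>
  have nonneg: "h (int k) = recurrence g 0 k" for k
    by (simp add: h_def)
  have nonpos: "h (- int k) = recurrence (\<lambda>y. g (- y)) (g 0) k" for k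
    by (cases k) (simp_all add: h_def nat_add_distrib)
  have "h (x - 1) + h (x + 1) = g x" for x
  proof -
    consider k where "x = int k + 1" | "x = 0" | k where "x = - (int k + 1)"
    proof -
      have "x = int (nat (x - 1)) + 1 \<or> x = 0 \<or> x = - (int (nat (- x - 1)) + 1)" by linarith
      then show ?thesis using that by blast
    qed
    then show ?thesis
    proof cases
      case (1 k)
      then show ?thesis using nonneg[of k] nonneg[of "Suc (Suc k)"] by (simp add: add.commute)
    next
      case 2
      then show ?thesis using nonneg[of 1] nonpos[of 1] by simp
    next
      case (3 k)
      then have "x - 1 = - int (Suc (Suc k))" "x + 1 = - int k" "x = - (int k + 1)" by auto
      then show ?thesis by (simp only: nonpos) simp
    qed
  qed
  moreover have "h x = 0" if "\<forall>y. \<bar>y\<bar> < int n \<longrightarrow> g y = 0" "\<bar>x\<bar> \<le> int n" for n x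
    unfolding h_def using that by (auto intro!: recurrence_eq_0[of n])
  ultimately show ?thesis by blast
qed

lemma spread_eq:
  "spread e (x, y) = (e (x - 1, y - 1) + e (x - 1, y + 1)) + (e (x + 1, y - 1) + e (x + 1, y + 1))"
  by (simp add: spread_def DIR_def ac_simps)

text \<open>
  The zeros are confined to a strip in the first coordinate only, which is all that is needed for
  each vertex to be corrected finitely often.
\<close>

lemma spread_surj:
  fixes g :: "point \<Rightarrow> int"
  shows "\<exists>h. spread h = g \<and>
    (\<forall>n. (\<forall>y. \<bar>fst y\<bar> < int n \<longrightarrow> g y = 0) \<longrightarrow> (\<forall>x. \<bar>fst x\<bar> \<le> int n \<longrightarrow> h x = 0))"
proof -
  \<comment> \<open>First the equation in the first coordinate for each value of the second, then conversely.\<close>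
  have "\<forall>y. \<exists>k. (\<forall>x. k (x - 1) + k (x + 1) = g (x, y)) \<and>
    (\<forall>n. (\<forall>z. \<bar>z\<bar> < int n \<longrightarrow> g (z, y) = 0) \<longrightarrow> (\<forall>x. \<bar>x\<bar> \<le> int n \<longrightarrow> k x = 0))"
    using neighbour_sum_surj[of "\<lambda>x. g (x, _)"] by blast
  then obtain k where k: "\<And>x y. k y (x - 1) + k y (x + 1) = g (x, y)"
    and k0: "\<And>n x y. (\<forall>z. \<bar>z\<bar> < int n \<longrightarrow> g (z, y) = 0) \<Longrightarrow> \<bar>x\<bar> \<le> int n \<Longrightarrow> k y x = 0"
    using choice by (metis (no_types, lifting))
  have "\<forall>x. \<exists>h. (\<forall>y. h (y - 1) + h (y + 1) = k y x) \<and>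
    (\<forall>n. (\<forall>z. \<bar>z\<bar> < int n \<longrightarrow> k z x = 0) \<longrightarrow> (\<forall>y. \<bar>y\<bar> \<le> int n \<longrightarrow> h y = 0))"
    using neighbour_sum_surj[of "\<lambda>y. k y _"] by blast
  then obtain h where h: "\<And>x y. h x (y - 1) + h x (y + 1) = k y x"
    and h0: "\<And>n x y. (\<forall>z. \<bar>z\<bar> < int n \<longrightarrow> k z x = 0) \<Longrightarrow> \<bar>y\<bar> \<le> int n \<Longrightarrow> h x y = 0"
    using choice by (metis (no_types, lifting))
  have "spread (\<lambda>(x, y). h x y) = g"
    by (auto simp: spread_eq h k)
  moreover have "h x y = 0" if "\<forall>p. \<bar>fst p\<bar> < int n \<longrightarrow> g p = 0" "\<bar>x\<bar> \<le> int n" for n x y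
  proof (rule h0)
    \<comment> \<open>The whole line over \<open>x\<close> of the intermediate function vanishes, so any bound may be used.\<close>
    show "\<forall>z. \<bar>z\<bar> < int (nat \<bar>y\<bar>) \<longrightarrow> k z x = 0" using k0[of n] that by auto
  qed simp
  ultimately show ?thesis by (intro exI[of _ "\<lambda>(x, y). h x y"]) auto
qed

lemma funpow_spread_surj:
  fixes g :: "point \<Rightarrow> int"
  shows "\<exists>h. (spread ^^ T) h = g \<and> (\<forall>x. \<bar>fst x\<bar> < int T \<longrightarrow> h x = 0)"
proof (induction T)
  case (Suc T)
  then obtain k where k: "(spread ^^ T) k = g" "\<forall>x. \<bar>fst x\<bar> < int T \<longrightarrow> k x = 0" by blast
  obtain h where "spread h = k" "\<forall>x. \<bar>fst x\<bar> \<le> int T \<longrightarrow> h x = 0"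
    using spread_surj[of k] k(2) by blast
  with k(1) show ?case by (intro exI[of _ h]) (simp add: funpow_Suc_right del: funpow.simps)
qed simp

text \<open>
  Values at points \<open>y \<sim> 0\<close> alone determine the result at points \<open>x \<sim> T\<close>, so a solution of the linear
  system may be set to 0 at the other points.
\<close>

lemma funpow_spread_cong:
  fixes e :: "point \<Rightarrow> nat" and E :: "point \<Rightarrow> int"
  assumes "\<And>y. y \<sim> 0 \<Longrightarrow> [int (e y) = E y] (mod m)" "x \<sim> T"
  shows "[int ((spread ^^ T) e x) = (spread ^^ T) E x] (mod m)"
  using assms(2)
proof (induction T arbitrary: x)
  case (Suc T)
  have "[(\<Sum>A\<in>DIR. int ((spread ^^ T) e (x - A))) = (\<Sum>A\<in>DIR. (spread ^^ T) E (x - A))] (mod m)"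
    using Suc by (intro cong_sum) (simp add: parity_match_diff_DIR)
  then show ?case by (simp add: spread_def[of "(spread ^^ T) _"])
qed (use assms(1) in simp)

lemma exists_piles:
  fixes g :: "point \<Rightarrow> int"
  shows "\<exists>e :: point \<Rightarrow> nat. (\<forall>x. x \<sim> T \<longrightarrow> [int ((spread ^^ T) e x) = g x] (mod 4)) \<and>
    (\<forall>x. \<bar>fst x\<bar> < int T \<longrightarrow> e x = 0) \<and> (\<forall>x. \<not> x \<sim> 0 \<longrightarrow> e x = 0)"
proof -
  obtain h where h: "(spread ^^ T) h = g" "\<And>x. \<bar>fst x\<bar> < int T \<Longrightarrow> h x = 0"
    using funpow_spread_surj[of T g] by blast
  define e where "e x = (if x \<sim> 0 then nat (h x mod 4) else 0)" for x
  have "[int ((spread ^^ T) e x) = (spread ^^ T) h x] (mod 4)" if "x \<sim> T" for x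
    using that by (intro funpow_spread_cong) (simp_all add: e_def cong_def)
  then show ?thesis using h by (intro exI[of _ e]) (auto simp: e_def)
qed

section \<open>Prescribing the chip numbers one time step after the other\<close>

theorem theorem1:
  fixes NEXT :: "point \<Rightarrow> point"
    and ARR0 :: "point \<Rightarrow> point"
    and \<pi> :: "point \<Rightarrow> nat \<Rightarrow> nat"
  assumes "rotor_sequence NEXT"
    and "ARR0 \<in> V \<rightarrow> DIR"
    and "\<And>x t. x \<in> V \<Longrightarrow> \<pi> x t \<in> {0, 1, 2, 3}"
    and "\<And>x t. x \<in> V \<Longrightarrow> \<not> x \<sim> t \<Longrightarrow> \<pi> x t = 0"
  shows "\<exists>f0 :: point \<Rightarrow> nat.
    even_config \<lparr>chips = f0, rotor = ARR0\<rparr> \<and>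
    (\<forall>x\<in>V. \<forall>t. [chips (propp_run NEXT \<lparr>chips = f0, rotor = ARR0\<rparr> t) x = \<pi> x t] (mod 4))"
proof -
  define run where "run f = propp_run NEXT \<lparr>chips = f, rotor = ARR0\<rparr>" for f
  \<comment> \<open>\<open>good n f\<close>: the residues are right at all times before \<open>n\<close>; \<open>ext n f f'\<close>: \<open>f'\<close> arises from
    \<open>f\<close> by the correction for time \<open>n\<close>.\<close>
  define good where "good n f \<longleftrightarrow> even_config \<lparr>chips = f, rotor = ARR0\<rparr> \<and>
    (\<forall>x\<in>V. \<forall>t<n. [chips (run f t) x = \<pi> x t] (mod 4))" for n f
  define ext where "ext n f f' \<longleftrightarrow> (\<exists>e. (\<forall>x. f' x = f x + 4 ^ n * e x) \<and>
    (\<forall>x. \<bar>fst x\<bar> < int n \<longrightarrow> e x = (0::nat)))" for n :: nat and f f' :: "point \<Rightarrow> nat"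
  have add: "chips (run f' s) x = chips (run f s) x + 4 ^ (n - s) * (spread ^^ s) e x"
    if "\<And>x. f' x = f x + 4 ^ n * e x" "s \<le> n" "x \<in> V" for f f' e n s x
    unfolding run_def using propp_run_add_piles[of NEXT "\<lparr>chips = f, rotor = ARR0\<rparr>"
        "\<lparr>chips = f', rotor = ARR0\<rparr>" n e s x] assms(1,2) that by auto
  have add_cong: "[chips (run f' s) x = chips (run f s) x] (mod 4)"
    if "\<And>x. f' x = f x + 4 ^ n * e x" "s < n" "x \<in> V" for f f' e n s x
  proof -
    have "4 ^ (n - s) = 4 * (4 ^ (n - Suc s) :: nat)"
      using that(2) by (simp flip: power_Suc add: Suc_diff_Suc)
    then show ?thesis using add[of f' f n e s x] that by (simp add: cong_def mult.assoc)
  qed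
  have "\<exists>F. \<forall>n. good n (F n) \<and> ext n (F n) (F (Suc n))"
  proof (rule dependent_nat_choice)
    show "\<exists>f. good 0 f"
      by (rule exI[of _ "\<lambda>_. 0"]) (simp add: good_def even_config_def)
    fix f n assume f: "good n f"
    define g where "g x = int (\<pi> x n) - int (chips (run f n) x)" for x
    obtain e :: "point \<Rightarrow> nat" where e: "\<And>x. x \<sim> n \<Longrightarrow> [int ((spread ^^ n) e x) = g x] (mod 4)"
      "\<forall>x. \<bar>fst x\<bar> < int n \<longrightarrow> e x = 0" "\<And>x. \<not> x \<sim> 0 \<Longrightarrow> e x = 0"
      using exists_piles[of n g] by blast
    define f' where "f' x = f x + 4 ^ n * e x" for x
    have even: "even_config \<lparr>chips = f', rotor = ARR0\<rparr>"
      using f e(3) by (fastforce simp: good_def even_config_def f'_def)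
    have "[chips (run f' t) x = \<pi> x t] (mod 4)" if "x \<in> V" "t < Suc n" for x t
    proof (cases "t < n")
      case True
      then have "[chips (run f t) x = \<pi> x t] (mod 4)" using f that(1) by (simp add: good_def)
      with add_cong[OF f'_def True that(1)] show ?thesis by (rule cong_trans)
    next
      case False
      then have t: "t = n" using that(2) by simp
      show ?thesis
      proof (cases "x \<sim> n")
        case True
        have "[int (chips (run f n) x) + int ((spread ^^ n) e x)
             = int (chips (run f n) x) + g x] (mod 4)"
          using e(1)[OF True] by (intro cong_add) auto
        then have "[int (chips (run f' n) x) = int (\<pi> x n)] (mod int 4)"
          using add[OF f'_def order_refl that(1)] by (simp add: g_def)
        then show ?thesis unfolding t cong_int_iff .
      next
        case False
        \<comment> \<open>No chip is ever on a vertex of the wrong parity, and the prescribed residue is 0.\<close>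
        then show ?thesis
          using chips_propp_run_parity[OF even False] assms(4)[OF that(1) False]
          by (simp add: t run_def)
      qed
    qed
    then have "good (Suc n) f'" using even by (simp add: good_def)
    moreover have "ext n f f'" using e(2) f'_def by (auto simp: ext_def)
    ultimately show "\<exists>f'. good (Suc n) f' \<and> ext n f f'" by blast
  qed
  then obtain F where good: "\<And>n. good n (F n)" and ext: "\<And>n. ext n (F n) (F (Suc n))" by blast
  obtain e where F_Suc: "\<And>n x. F (Suc n) x = F n x + 4 ^ n * e n x"
    and e0: "\<And>n x. \<bar>fst x\<bar> < int n \<Longrightarrow> e n x = 0"
    using ext unfolding ext_def by metis
  \<comment> \<open>The correction for time \<open>n\<close> vanishes at \<open>x\<close> once \<open>n > \<bar>fst x\<bar>\<close>, so this is the limit of the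
    values \<open>F n x\<close>.\<close>
  define f0 where "f0 x = F (Suc (nat \<bar>fst x\<bar>)) x" for x
  have F_add: "\<exists>r. F (n + k) x = F n x + 4 ^ n * r" for n k x
  proof (induction k)
    case (Suc k)
    then obtain r where "F (n + k) x = F n x + 4 ^ n * r" by blast
    then have "F (n + Suc k) x = F n x + 4 ^ n * (r + 4 ^ k * e (n + k) x)"
      by (simp add: F_Suc power_add algebra_simps)
    then show ?case by blast
  qed (auto intro: exI[of _ 0])
  have F_stable: "F (Suc (nat \<bar>fst x\<bar>) + k) x = f0 x" for x k
    by (induction k) (simp_all add: f0_def F_Suc e0)
  have f0_eq: "\<forall>x. \<exists>r. f0 x = F n x + 4 ^ n * r" for n
  proof
    fix x
    show "\<exists>r. f0 x = F n x + 4 ^ n * r"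
      using F_add[of n "Suc (nat \<bar>fst x\<bar>)" x] F_stable[of x n] by (simp add: add.commute)
  qed
  have "even_config \<lparr>chips = f0, rotor = ARR0\<rparr>"
    using good by (auto simp: good_def even_config_def f0_def)
  moreover have "[chips (run f0 t) x = \<pi> x t] (mod 4)" if "x \<in> V" for x t
  proof -
    obtain r where "\<forall>x. f0 x = F (Suc t) x + 4 ^ Suc t * r x"
      using choice[OF f0_eq] by blast
    then have "[chips (run f0 t) x = chips (run (F (Suc t)) t) x] (mod 4)"
      using that by (intro add_cong) auto
    moreover have "[chips (run (F (Suc t)) t) x = \<pi> x t] (mod 4)"
      using good[of "Suc t"] that by (simp add: good_def)
    ultimately show ?thesis by (rule cong_trans)
  qed
  ultimately show ?thesis unfolding run_def by blast
qed

end
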